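(* Let $\kappa$ be a field, $G$ a group, $\rho\in pm(G)$, and let $\rho^*(g,h)=\rho(h^{-1},g^{-1})$ for $g,h\in G$ (which again belongs to $pm(G)$). Then the algebras $\kappa_{par}^{\rho^*}G$ and $(\kappa_{par}^\rho G)^{op}$ are isomorphic. Consequently, the category of left $\kappa_{par}^\rho G$-modules and the category of right $\kappa_{par}^{\rho^*}G$-modules are isomorphic.
   Context: Algebras are associative and unital with $1\neq0$. A partial projective representation of $G$ in a unital $\kappa$-algebra $R$ is a map $\Gamma:G\to R$ for which there is $\sigma:G\times G\to\kappa$ such that for all $g,h\in G$: (1) $\sigma(g,h)=0$ implies $\Gamma(g^{-1})\Gamma(gh)=0$ and $\Gamma(gh)\Gamma(h^{-1})=0$; (2) $\Gamma(g^{-1})\Gamma(g)\Gamma(h)=\sigma(g,h)\Gamma(g^{-1})\Gamma(gh)$; (3) $\Gamma(g)\Gamma(h)\Gamma(h^{-1})=\sigma(g,h)\Gamma(gh)\Gamma(h^{-1})$; (4) $\Gamma(1_G)=1_R$. If moreover $\Gamma(g)\Gamma(h)=0$ implies $\sigma(g,h)=0$, then $\sigma$ is called a factor set of $\Gamma$. $pm(G)$ is the set of all factor sets of partial projective representations of $G$ in unital $\kappa$-algebras. For $\rho\in pm(G)$, the twisted partial group algebra $\kappa_{par}^\rho G$ is the universal unital $\kappa$-algebra generated by symbols $[g]^\rho$ ($g\in G$) subject to: $[g^{-1}]^\rho[gh]^\rho=[gh]^\rho[h^{-1}]^\rho=0$ whenever $\rho(g,h)=0$; $[g^{-1}]^\rho[g]^\rho[h]^\rho=\rho(g,h)[g^{-1}]^\rho[gh]^\rho$;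 $[g]^\rho[h]^\rho[h^{-1}]^\rho=\rho(g,h)[gh]^\rho[h^{-1}]^\rho$; $[g]^\rho[1_G]^\rho=[1_G]^\rho[g]^\rho=[g]^\rho$, for all $g,h\in G$. $R^{op}$ denotes the opposite algebra. *)

theory Defs
  imports "HOL-Algebra.Module" "HOL-Algebra.QuotRing"
begin

section \<open>Unital associative algebras\<close>

text \<open>The locale \<^verbatim>\<open>algebra\<close> of HOL-Algebra is about commutative algebras. Here
  the algebra need not be commutative, and it is nonzero.\<close>

locale unital_algebra = module K A + ring A
  for K :: "('k, 'c) ring_scheme" (structure) and A :: "('k, 'a, 'd) module_scheme" (structure) +
  assumes smult_assoc_left:
      "\<lbrakk>a \<in> carrier K; x \<in> carrier A; y \<in> carrier A\<rbrakk> \<Longrightarrow>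
        (a \<odot>\<^bsub>A\<^esub> x) \<otimes>\<^bsub>A\<^esub> y = a \<odot>\<^bsub>A\<^esub> (x \<otimes>\<^bsub>A\<^esub> y)"
    and smult_assoc_right:
      "\<lbrakk>a \<in> carrier K; x \<in> carrier A; y \<in> carrier A\<rbrakk> \<Longrightarrow>
        x \<otimes>\<^bsub>A\<^esub> (a \<odot>\<^bsub>A\<^esub> y) = a \<odot>\<^bsub>A\<^esub> (x \<otimes>\<^bsub>A\<^esub> y)"
    and one_neq_zero: "\<one>\<^bsub>A\<^esub> \<noteq> \<zero>\<^bsub>A\<^esub>"

definition opposite_algebra :: "('k, 'a, 'd) module_scheme \<Rightarrow> ('k, 'a, 'd) module_scheme" where
  "opposite_algebra A = A\<lparr>mult := \<lambda>x y. y \<otimes>\<^bsub>A\<^esub> x\<rparr>"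

definition algebra_iso ::
  "('k, 'c) ring_scheme \<Rightarrow> ('k, 'a, 'd) module_scheme \<Rightarrow> ('k, 'b, 'e) module_scheme \<Rightarrow> ('a \<Rightarrow> 'b) set" where
  "algebra_iso K A B = {\<phi> \<in> ring_iso A B.
     \<forall>a\<in>carrier K. \<forall>x\<in>carrier A. \<phi> (a \<odot>\<^bsub>A\<^esub> x) = a \<odot>\<^bsub>B\<^esub> \<phi> x}"

definition algebras_isomorphic ::
  "('k, 'c) ring_scheme \<Rightarrow> ('k, 'a, 'd) module_scheme \<Rightarrow> ('k, 'b, 'e) module_scheme \<Rightarrow> bool" where
  "algebras_isomorphic K A B \<longleftrightarrow> algebra_iso K A B \<noteq> {}"


section \<open>Partial projective representations and their factor sets\<close>

definition partial_projective_rep_with ::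
  "('k, 'c) ring_scheme \<Rightarrow> ('g, 'b) monoid_scheme \<Rightarrow> ('k, 'r, 'd) module_scheme \<Rightarrow>
    ('g \<Rightarrow> 'r) \<Rightarrow> ('g \<Rightarrow> 'g \<Rightarrow> 'k) \<Rightarrow> bool" where
  "partial_projective_rep_with K G R \<Gamma> \<sigma> \<longleftrightarrow>
     \<Gamma> \<in> carrier G \<rightarrow> carrier R \<and>
     \<sigma> \<in> carrier G \<rightarrow> carrier G \<rightarrow> carrier K \<and>
     (\<forall>g\<in>carrier G. \<forall>h\<in>carrier G.
        (\<sigma> g h = \<zero>\<^bsub>K\<^esub> \<longrightarrow>
           \<Gamma> (inv\<^bsub>G\<^esub> g) \<otimes>\<^bsub>R\<^esub> \<Gamma> (g \<otimes>\<^bsub>G\<^esub> h) = \<zero>\<^bsub>R\<^esub> \<and>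
           \<Gamma> (g \<otimes>\<^bsub>G\<^esub> h) \<otimes>\<^bsub>R\<^esub> \<Gamma> (inv\<^bsub>G\<^esub> h) = \<zero>\<^bsub>R\<^esub>) \<and>
        \<Gamma> (inv\<^bsub>G\<^esub> g) \<otimes>\<^bsub>R\<^esub> \<Gamma> g \<otimes>\<^bsub>R\<^esub> \<Gamma> h =
          \<sigma> g h \<odot>\<^bsub>R\<^esub> (\<Gamma> (inv\<^bsub>G\<^esub> g) \<otimes>\<^bsub>R\<^esub> \<Gamma> (g \<otimes>\<^bsub>G\<^esub> h)) \<and>
        \<Gamma> g \<otimes>\<^bsub>R\<^esub> \<Gamma> h \<otimes>\<^bsub>R\<^esub> \<Gamma> (inv\<^bsub>G\<^esub> h) =
          \<sigma> g h \<odot>\<^bsub>R\<^esub> (\<Gamma> (g \<otimes>\<^bsub>G\<^esub> h) \<otimes>\<^bsub>R\<^esub> \<Gamma> (inv\<^bsub>G\<^esub> h))) \<and>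
     \<Gamma> \<one>\<^bsub>G\<^esub> = \<one>\<^bsub>R\<^esub>"

definition is_factor_set ::
  "('k, 'c) ring_scheme \<Rightarrow> ('g, 'b) monoid_scheme \<Rightarrow> ('k, 'r, 'd) module_scheme \<Rightarrow>
    ('g \<Rightarrow> 'r) \<Rightarrow> ('g \<Rightarrow> 'g \<Rightarrow> 'k) \<Rightarrow> bool" where
  "is_factor_set K G R \<Gamma> \<sigma> \<longleftrightarrow>
     partial_projective_rep_with K G R \<Gamma> \<sigma> \<and>
     (\<forall>g\<in>carrier G. \<forall>h\<in>carrier G. \<Gamma> g \<otimes>\<^bsub>R\<^esub> \<Gamma> h = \<zero>\<^bsub>R\<^esub> \<longrightarrow> \<sigma> g h = \<zero>\<^bsub>K\<^esub>)"

text \<open>HOL cannot quantify over types inside a formula, so the type \<^verbatim>\<open>'r\<close> whose elements may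
  serve as elements of the representing algebras is an explicit parameter. A theorem in which
  \<^verbatim>\<open>'r\<close> is a type variable speaks about the representations in all unital algebras.\<close>

definition pm ::
  "'r itself \<Rightarrow> ('k, 'c) ring_scheme \<Rightarrow> ('g, 'b) monoid_scheme \<Rightarrow> ('g \<Rightarrow> 'g \<Rightarrow> 'k) set" where
  "pm _ K G = {\<sigma>. \<exists>(R :: ('k, 'r) module) \<Gamma>. unital_algebra K R \<and> is_factor_set K G R \<Gamma> \<sigma>}"

definition dual_factor_set :: "('g, 'b) monoid_scheme \<Rightarrow> ('g \<Rightarrow> 'g \<Rightarrow> 'k) \<Rightarrow> ('g \<Rightarrow> 'g \<Rightarrow> 'k)" where
  "dual_factor_set G \<rho> = (\<lambda>g h. \<rho> (inv\<^bsub>G\<^esub> h) (inv\<^bsub>G\<^esub> g))"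


section \<open>The twisted partial group algebra\<close>

text \<open>The free unital algebra on a set \<^verbatim>\<open>X\<close>: finitely supported coefficient functions on the words
  over \<^verbatim>\<open>X\<close>, multiplied by convolution along the factorizations of a word.\<close>

definition free_algebra :: "('k, 'c) ring_scheme \<Rightarrow> 'x set \<Rightarrow> ('k, 'x list \<Rightarrow> 'k) module" where
  "free_algebra K X =
    \<lparr>carrier = {p. (\<forall>w. p w \<in> carrier K) \<and> finite {w. p w \<noteq> \<zero>\<^bsub>K\<^esub>} \<and>
                   (\<forall>w. p w \<noteq> \<zero>\<^bsub>K\<^esub> \<longrightarrow> set w \<subseteq> X)},
     mult = (\<lambda>p q w. \<Oplus>\<^bsub>K\<^esub>i\<in>{..length w}. p (take i w) \<otimes>\<^bsub>K\<^esub> q (drop i w)),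
     one = (\<lambda>w. if w = [] then \<one>\<^bsub>K\<^esub> else \<zero>\<^bsub>K\<^esub>),
     zero = (\<lambda>w. \<zero>\<^bsub>K\<^esub>),
     add = (\<lambda>p q w. p w \<oplus>\<^bsub>K\<^esub> q w),
     smult = (\<lambda>a p w. a \<otimes>\<^bsub>K\<^esub> p w)\<rparr>"

definition word :: "('k, 'c) ring_scheme \<Rightarrow> 'x list \<Rightarrow> ('x list \<Rightarrow> 'k)" where
  "word K u = (\<lambda>w. if w = u then \<one>\<^bsub>K\<^esub> else \<zero>\<^bsub>K\<^esub>)"

text \<open>Quotient of an algebra by a two-sided ideal. As for \<^verbatim>\<open>rcoset_mult\<close>, the scalar
  multiple of a coset is the union of the cosets of the multiples of its elements, which all agree.\<close>

definition quotient_algebra :: "('k, 'a) module \<Rightarrow> 'a set \<Rightarrow> ('k, 'a set) module" where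
  "quotient_algebra A I = ring.extend (A Quot I)
     (module.fields (\<lambda>a C. \<Union>x\<in>C. I +>\<^bsub>A\<^esub> (a \<odot>\<^bsub>A\<^esub> x)))"

text \<open>Elements of the free algebra on the symbols \<^verbatim>\<open>[g]\<close> that are declared to be zero. The
  requirement \<^verbatim>\<open>[g][1] = [1][g] = [g]\<close> says that \<^verbatim>\<open>[1]\<close> is the unit of the algebra, as it must
  be for \<^verbatim>\<open>g \<mapsto> [g]\<close> to be a partial projective representation. The free algebra also has the
  empty word as its unit, and without the last relator, which identifies it with \<^verbatim>\<open>[1]\<close>,
  the quotient would have a spurious direct factor \<^verbatim>\<open>K\<close>.\<close>

definition twisted_relators ::
  "('k, 'c) ring_scheme \<Rightarrow> ('g, 'b) monoid_scheme \<Rightarrow> ('g \<Rightarrow> 'g \<Rightarrow> 'k) \<Rightarrow> ('g list \<Rightarrow> 'k) set" where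
  "twisted_relators K G \<rho> = (let F = free_algebra K (carrier G) in
     (\<Union>g\<in>carrier G. \<Union>h\<in>carrier G.
        (if \<rho> g h = \<zero>\<^bsub>K\<^esub>
         then {word K [inv\<^bsub>G\<^esub> g, g \<otimes>\<^bsub>G\<^esub> h], word K [g \<otimes>\<^bsub>G\<^esub> h, inv\<^bsub>G\<^esub> h]} else {}) \<union>
        {word K [inv\<^bsub>G\<^esub> g, g, h] \<ominus>\<^bsub>F\<^esub> \<rho> g h \<odot>\<^bsub>F\<^esub> word K [inv\<^bsub>G\<^esub> g, g \<otimes>\<^bsub>G\<^esub> h],
         word K [g, h, inv\<^bsub>G\<^esub> h] \<ominus>\<^bsub>F\<^esub> \<rho> g h \<odot>\<^bsub>F\<^esub> word K [g \<otimes>\<^bsub>G\<^esub> h, inv\<^bsub>G\<^esub> h]}) \<union>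
     (\<Union>g\<in>carrier G. {word K [g, \<one>\<^bsub>G\<^esub>] \<ominus>\<^bsub>F\<^esub> word K [g], word K [\<one>\<^bsub>G\<^esub>, g] \<ominus>\<^bsub>F\<^esub> word K [g]}) \<union>
     {word K [\<one>\<^bsub>G\<^esub>] \<ominus>\<^bsub>F\<^esub> \<one>\<^bsub>F\<^esub>})"

definition twisted_partial_group_algebra ::
  "('k, 'c) ring_scheme \<Rightarrow> ('g, 'b) monoid_scheme \<Rightarrow> ('g \<Rightarrow> 'g \<Rightarrow> 'k) \<Rightarrow>
    ('k, ('g list \<Rightarrow> 'k) set) module" where
  "twisted_partial_group_algebra K G \<rho> =
     (let F = free_algebra K (carrier G) in
       quotient_algebra F (genideal F (twisted_relators K G \<rho>)))"


section \<open>Categories\<close>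

record ('o, 'a) cat =
  Obj :: "'o set"
  Hom :: "'o \<Rightarrow> 'o \<Rightarrow> 'a set"
  Id :: "'o \<Rightarrow> 'a"
  Comp :: "'o \<Rightarrow> 'o \<Rightarrow> 'o \<Rightarrow> 'a \<Rightarrow> 'a \<Rightarrow> 'a"

text \<open>Hom-sets need not be disjoint, which is why composition takes the objects as arguments:
  \<^verbatim>\<open>Comp C X Y Z g f\<close> is the composite of \<^verbatim>\<open>f : X \<rightarrow> Y\<close> and \<^verbatim>\<open>g : Y \<rightarrow> Z\<close>.\<close>

definition category :: "('o, 'a) cat \<Rightarrow> bool" where
  "category C \<longleftrightarrow>
     (\<forall>X\<in>Obj C. Id C X \<in> Hom C X X) \<and>
     (\<forall>X\<in>Obj C. \<forall>Y\<in>Obj C. \<forall>Z\<in>Obj C. \<forall>f\<in>Hom C X Y. \<forall>g\<in>Hom C Y Z.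
        Comp C X Y Z g f \<in> Hom C X Z) \<and>
     (\<forall>X\<in>Obj C. \<forall>Y\<in>Obj C. \<forall>f\<in>Hom C X Y.
        Comp C X X Y f (Id C X) = f \<and> Comp C X Y Y (Id C Y) f = f) \<and>
     (\<forall>W\<in>Obj C. \<forall>X\<in>Obj C. \<forall>Y\<in>Obj C. \<forall>Z\<in>Obj C.
        \<forall>f\<in>Hom C W X. \<forall>g\<in>Hom C X Y. \<forall>h\<in>Hom C Y Z.
        Comp C W X Z (Comp C X Y Z h g) f = Comp C W Y Z h (Comp C W X Y g f))"

definition is_functor ::
  "('o, 'a) cat \<Rightarrow> ('p, 'b) cat \<Rightarrow> ('o \<Rightarrow> 'p) \<Rightarrow> ('o \<Rightarrow> 'o \<Rightarrow> 'a \<Rightarrow> 'b) \<Rightarrow> bool" where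
  "is_functor C D F F' \<longleftrightarrow>
     (\<forall>X\<in>Obj C. F X \<in> Obj D) \<and>
     (\<forall>X\<in>Obj C. \<forall>Y\<in>Obj C. \<forall>f\<in>Hom C X Y. F' X Y f \<in> Hom D (F X) (F Y)) \<and>
     (\<forall>X\<in>Obj C. F' X X (Id C X) = Id D (F X)) \<and>
     (\<forall>X\<in>Obj C. \<forall>Y\<in>Obj C. \<forall>Z\<in>Obj C. \<forall>f\<in>Hom C X Y. \<forall>g\<in>Hom C Y Z.
        F' X Z (Comp C X Y Z g f) = Comp D (F X) (F Y) (F Z) (F' Y Z g) (F' X Y f))"

definition categories_isomorphic :: "('o, 'a) cat \<Rightarrow> ('p, 'b) cat \<Rightarrow> bool" where
  "categories_isomorphic C D \<longleftrightarrow> category C \<and> category D \<and>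
     (\<exists>F F' H H'. is_functor C D F F' \<and> is_functor D C H H' \<and>
        (\<forall>X\<in>Obj C. H (F X) = X) \<and>
        (\<forall>X\<in>Obj C. \<forall>Y\<in>Obj C. \<forall>f\<in>Hom C X Y. H' (F X) (F Y) (F' X Y f) = f) \<and>
        (\<forall>X\<in>Obj D. F (H X) = X) \<and>
        (\<forall>X\<in>Obj D. \<forall>Y\<in>Obj D. \<forall>f\<in>Hom D X Y. F' (H X) (H Y) (H' X Y f) = f))"


section \<open>Categories of modules over a not necessarily commutative ring\<close>

text \<open>The underlying abelian group of a module is a commutative group in the sense of
  HOL-Algebra, so \<^verbatim>\<open>\<otimes>\<close> is the addition of the module. For a right module, \<^verbatim>\<open>act M a m\<close>
  stands for \<^verbatim>\<open>m \<cdot> a\<close>.\<close>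

record ('a, 'm) action = "'m monoid" +
  act :: "'a \<Rightarrow> 'm \<Rightarrow> 'm"

text \<open>All operations are undefined outside the carriers, so that different objects really are
  different modules, and the equality of objects is that of modules.\<close>

definition additive_action :: "('a, 'c) ring_scheme \<Rightarrow> ('a, 'm) action \<Rightarrow> bool" where
  "additive_action A M \<longleftrightarrow>
     comm_group M \<and>
     mult M \<in> carrier M \<rightarrow>\<^sub>E (carrier M \<rightarrow>\<^sub>E carrier M) \<and>
     act M \<in> carrier A \<rightarrow>\<^sub>E (carrier M \<rightarrow>\<^sub>E carrier M) \<and>
     (\<forall>a\<in>carrier A. \<forall>m\<in>carrier M. \<forall>n\<in>carrier M.
        act M a (m \<otimes>\<^bsub>M\<^esub> n) = act M a m \<otimes>\<^bsub>M\<^esub> act M a n) \<and>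
     (\<forall>a\<in>carrier A. \<forall>b\<in>carrier A. \<forall>m\<in>carrier M.
        act M (a \<oplus>\<^bsub>A\<^esub> b) m = act M a m \<otimes>\<^bsub>M\<^esub> act M b m) \<and>
     (\<forall>m\<in>carrier M. act M \<one>\<^bsub>A\<^esub> m = m)"

definition left_module :: "('a, 'c) ring_scheme \<Rightarrow> ('a, 'm) action \<Rightarrow> bool" where
  "left_module A M \<longleftrightarrow> additive_action A M \<and>
     (\<forall>a\<in>carrier A. \<forall>b\<in>carrier A. \<forall>m\<in>carrier M. act M (a \<otimes>\<^bsub>A\<^esub> b) m = act M a (act M b m))"

definition right_module :: "('a, 'c) ring_scheme \<Rightarrow> ('a, 'm) action \<Rightarrow> bool" where
  "right_module A M \<longleftrightarrow> additive_action A M \<and>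
     (\<forall>a\<in>carrier A. \<forall>b\<in>carrier A. \<forall>m\<in>carrier M. act M (a \<otimes>\<^bsub>A\<^esub> b) m = act M b (act M a m))"

definition module_homs ::
  "('a, 'c) ring_scheme \<Rightarrow> ('a, 'm) action \<Rightarrow> ('a, 'm) action \<Rightarrow> ('m \<Rightarrow> 'm) set" where
  "module_homs A M N = {f \<in> carrier M \<rightarrow>\<^sub>E carrier N.
     (\<forall>m\<in>carrier M. \<forall>n\<in>carrier M. f (m \<otimes>\<^bsub>M\<^esub> n) = f m \<otimes>\<^bsub>N\<^esub> f n) \<and>
     (\<forall>a\<in>carrier A. \<forall>m\<in>carrier M. f (act M a m) = act N a (f m))}"

text \<open>The parameter \<^verbatim>\<open>'m\<close> is the type whose elements may serve as elements of the modules.\<close>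

definition module_cat ::
  "('a, 'c) ring_scheme \<Rightarrow> ('a, 'm) action set \<Rightarrow> (('a, 'm) action, 'm \<Rightarrow> 'm) cat" where
  "module_cat A \<M> =
    \<lparr>Obj = \<M>, Hom = module_homs A, Id = (\<lambda>M. \<lambda>m\<in>carrier M. m),
     Comp = (\<lambda>L M N g f. compose (carrier L) g f)\<rparr>"

definition left_modules ::
  "'m itself \<Rightarrow> ('a, 'c) ring_scheme \<Rightarrow> (('a, 'm) action, 'm \<Rightarrow> 'm) cat" where
  "left_modules _ A = module_cat A {M. left_module A M}"

definition right_modules ::
  "'m itself \<Rightarrow> ('a, 'c) ring_scheme \<Rightarrow> (('a, 'm) action, 'm \<Rightarrow> 'm) cat" where
  "right_modules _ A = module_cat A {M. right_module A M}"

end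

theory Submission
  imports Defs
begin

text \<open>Everything comes from one symmetry: inversion of \<^verbatim>\<open>G\<close> reverses products, so sending
  \<^verbatim>\<open>[g]\<close> to \<^verbatim>\<open>[g\<inverse>]\<close> and reading words backwards exchanges the relations of the twist \<^verbatim>\<open>\<rho>\<close> at
  the pair \<^verbatim>\<open>(g, h)\<close> with those of \<^verbatim>\<open>\<rho>\<^sup>*\<close> at \<^verbatim>\<open>(h\<inverse>, g\<inverse>)\<close>, a left relation becoming a right
  one and conversely.

  For a representation \<^verbatim>\<open>\<Gamma>\<close> in \<^verbatim>\<open>R\<close> with factor set \<^verbatim>\<open>\<rho>\<close> this says that \<^verbatim>\<open>g \<mapsto> \<Gamma> (g\<inverse>)\<close> is a
  representation in the opposite algebra of \<^verbatim>\<open>R\<close> with factor set \<^verbatim>\<open>\<rho>\<^sup>*\<close>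
  (\<^verbatim>\<open>dual_factor_set_pm\<close>). For the universal algebras, the symmetry is an isomorphism \<^verbatim>\<open>\<theta>\<close> of the
  free algebra \<^verbatim>\<open>F\<close> on \<^verbatim>\<open>G\<close> onto its opposite (\<^verbatim>\<open>reverse_words_algebra_iso\<close>) which carries the
  relators of \<^verbatim>\<open>\<rho>\<^sup>*\<close> onto those of \<^verbatim>\<open>\<rho>\<close> (\<^verbatim>\<open>reverse_words_twisted_relators\<close>). An isomorphism of
  algebras descends to the quotients by the ideals generated by corresponding sets
  (\<^verbatim>\<open>algebra_iso_quotient\<close>), and an ideal of \<^verbatim>\<open>F\<close> is the same thing as an ideal of its opposite,
  with opposite quotient. Hence the algebra of \<^verbatim>\<open>\<rho>\<^sup>*\<close> is isomorphic to the opposite of that of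
  \<^verbatim>\<open>\<rho>\<close>.

  A left module over an algebra is literally a right module over the opposite algebra
  (\<^verbatim>\<open>right_modules_opposite_algebra\<close>), and restriction of scalars along an isomorphism of rings is
  an isomorphism of module categories (\<^verbatim>\<open>categories_isomorphic_right_modules\<close>).\<close>

section \<open>Free algebras\<close>

text \<open>Both sides sum over the triangle \<^verbatim>\<open>j + k \<le> n\<close>, once along the diagonals \<^verbatim>\<open>j + k = i\<close> and once
  along the rows of fixed \<^verbatim>\<open>j\<close>. With \<^verbatim>\<open>j\<close> and \<^verbatim>\<open>k\<close> the lengths of the first two factors of a word
  cut into three, this is the associativity of convolution.\<close>

lemma (in abelian_monoid) finsum_triangle:
  assumes "\<And>j k. f j k \<in> carrier G"
  shows "(\<Oplus>i\<in>{..n::nat}. \<Oplus>j\<in>{..i}. f j (i - j)) = (\<Oplus>j\<in>{..n}. \<Oplus>k\<in>{..n - j}. f j k)"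
proof (induction n)
  case 0
  then show ?case using assms by simp
next
  case (Suc n)
  let ?row = "\<lambda>n j. \<Oplus>k\<in>{..n - j}. f j k"
  have row_Suc: "?row (Suc n) j = f j (Suc n - j) \<oplus> ?row n j" if "j \<le> n" for j
    using that assms by (simp add: Suc_diff_le)
  have "(\<Oplus>j\<in>{..Suc n}. ?row (Suc n) j) = f (Suc n) 0 \<oplus> (\<Oplus>j\<in>{..n}. ?row (Suc n) j)"
    using assms by simp
  also have "(\<Oplus>j\<in>{..n}. ?row (Suc n) j) = (\<Oplus>j\<in>{..n}. f j (Suc n - j) \<oplus> ?row n j)"
    using assms row_Suc by (intro finsum_cong') auto
  also have "\<dots> = (\<Oplus>j\<in>{..n}. f j (Suc n - j)) \<oplus> (\<Oplus>j\<in>{..n}. ?row n j)"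
    using assms by (intro finsum_addf) auto
  also have "f (Suc n) 0 \<oplus> \<dots> = (\<Oplus>j\<in>{..Suc n}. f j (Suc n - j)) \<oplus> (\<Oplus>j\<in>{..n}. ?row n j)"
    using assms by (simp add: a_assoc)
  also have "\<dots> = (\<Oplus>i\<in>{..Suc n}. \<Oplus>j\<in>{..i}. f j (i - j))"
    using assms Suc by simp
  finally show ?case by simp
qed

lemma free_algebra_simps:
  "carrier (free_algebra K X) = {p. (\<forall>w. p w \<in> carrier K) \<and> finite {w. p w \<noteq> \<zero>\<^bsub>K\<^esub>} \<and>
     (\<forall>w. p w \<noteq> \<zero>\<^bsub>K\<^esub> \<longrightarrow> set w \<subseteq> X)}"
  "p \<otimes>\<^bsub>free_algebra K X\<^esub> q = (\<lambda>w. \<Oplus>\<^bsub>K\<^esub>i\<in>{..length w}. p (take i w) \<otimes>\<^bsub>K\<^esub> q (drop i w))"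
  "\<one>\<^bsub>free_algebra K X\<^esub> = (\<lambda>w. if w = [] then \<one>\<^bsub>K\<^esub> else \<zero>\<^bsub>K\<^esub>)"
  "\<zero>\<^bsub>free_algebra K X\<^esub> = (\<lambda>w. \<zero>\<^bsub>K\<^esub>)"
  "p \<oplus>\<^bsub>free_algebra K X\<^esub> q = (\<lambda>w. p w \<oplus>\<^bsub>K\<^esub> q w)"
  "a \<odot>\<^bsub>free_algebra K X\<^esub> p = (\<lambda>w. a \<otimes>\<^bsub>K\<^esub> p w)"
  by (simp_all add: free_algebra_def)

context cring
begin

lemma free_algebra_coeff_closed: "p \<in> carrier (free_algebra R X) \<Longrightarrow> p w \<in> carrier R"
  by (simp add: free_algebra_simps)

lemma free_algebra_support: "p \<in> carrier (free_algebra R X) \<Longrightarrow> \<not> set w \<subseteq> X \<Longrightarrow> p w = \<zero>"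
  by (auto simp: free_algebra_simps)

lemma free_algebra_word_closed: "set u \<subseteq> X \<Longrightarrow> word R u \<in> carrier (free_algebra R X)"
  by (auto simp: free_algebra_simps word_def)

lemma free_algebra_add_closed:
  assumes p: "p \<in> carrier (free_algebra R X)" and q: "q \<in> carrier (free_algebra R X)"
  shows "p \<oplus>\<^bsub>free_algebra R X\<^esub> q \<in> carrier (free_algebra R X)"
proof -
  have "{w. p w \<oplus> q w \<noteq> \<zero>} \<subseteq> {w. p w \<noteq> \<zero>} \<union> {w. q w \<noteq> \<zero>}"
    by auto
  then have "finite {w. p w \<oplus> q w \<noteq> \<zero>}"
    by (rule finite_subset) (use p q in \<open>simp add: free_algebra_simps\<close>)
  moreover have "set w \<subseteq> X" if "p w \<oplus> q w \<noteq> \<zero>" for w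
    using that p q by (cases "p w = \<zero>") (auto simp: free_algebra_simps)
  ultimately show ?thesis
    using p q by (auto simp: free_algebra_simps)
qed

lemma free_algebra_smult_closed:
  assumes a: "a \<in> carrier R" and p: "p \<in> carrier (free_algebra R X)"
  shows "a \<odot>\<^bsub>free_algebra R X\<^esub> p \<in> carrier (free_algebra R X)"
proof -
  have "{w. a \<otimes> p w \<noteq> \<zero>} \<subseteq> {w. p w \<noteq> \<zero>}"
    using a by auto
  then have "finite {w. a \<otimes> p w \<noteq> \<zero>}"
    by (rule finite_subset) (use p in \<open>simp add: free_algebra_simps\<close>)
  moreover have "set w \<subseteq> X" if "a \<otimes> p w \<noteq> \<zero>" for w
    using that a p by (cases "p w = \<zero>") (auto simp: free_algebra_simps)
  ultimately show ?thesis
    using a p by (auto simp: free_algebra_simps)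
qed

text \<open>A word in the support of a product is the concatenation of words in the supports of the
  factors, so there are finitely many of them.\<close>

lemma free_algebra_mult_closed:
  assumes p: "p \<in> carrier (free_algebra R X)" and q: "q \<in> carrier (free_algebra R X)"
  shows "p \<otimes>\<^bsub>free_algebra R X\<^esub> q \<in> carrier (free_algebra R X)"
proof -
  note pq = free_algebra_coeff_closed[OF p] free_algebra_coeff_closed[OF q]
  let ?conv = "\<lambda>w. \<Oplus>i\<in>{..length w}. p (take i w) \<otimes> q (drop i w)"
  have factor: "\<exists>u v. w = u @ v \<and> p u \<noteq> \<zero> \<and> q v \<noteq> \<zero>" if "?conv w \<noteq> \<zero>" for w
  proof (rule ccontr)
    assume no: "\<nexists>u v. w = u @ v \<and> p u \<noteq> \<zero> \<and> q v \<noteq> \<zero>"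
    have "p (take i w) \<otimes> q (drop i w) = \<zero>" for i
      using no[unfolded not_ex, rule_format, of "take i w" "drop i w"] pq by auto
    then show False
      using that by simp
  qed
  have "{w. ?conv w \<noteq> \<zero>} \<subseteq> (\<lambda>(u, v). u @ v) ` ({u. p u \<noteq> \<zero>} \<times> {v. q v \<noteq> \<zero>})"
    using factor by fastforce
  then have "finite {w. ?conv w \<noteq> \<zero>}"
    by (rule finite_subset) (use p q in \<open>simp add: free_algebra_simps\<close>)
  moreover have "set w \<subseteq> X" if "?conv w \<noteq> \<zero>" for w
    using factor[OF that] p q by (fastforce simp: free_algebra_simps)
  ultimately show ?thesis
    using pq by (auto simp: free_algebra_simps)
qed

lemma free_algebra_mult_assoc:
  fixes X :: "'x set"
  assumes p: "p \<in> carrier (free_algebra R X)" and q: "q \<in> carrier (free_algebra R X)"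
    and r: "r \<in> carrier (free_algebra R X)"
  shows "p \<otimes>\<^bsub>free_algebra R X\<^esub> q \<otimes>\<^bsub>free_algebra R X\<^esub> r =
    p \<otimes>\<^bsub>free_algebra R X\<^esub> (q \<otimes>\<^bsub>free_algebra R X\<^esub> r)"
proof
  fix w :: "'x list"
  note [simp] = free_algebra_coeff_closed[OF p] free_algebra_coeff_closed[OF q]
    free_algebra_coeff_closed[OF r]
  let ?n = "length w"
  let ?f = "\<lambda>j k. p (take j w) \<otimes> (q (take k (drop j w)) \<otimes> r (drop (j + k) w))"
  have "(p \<otimes>\<^bsub>free_algebra R X\<^esub> q \<otimes>\<^bsub>free_algebra R X\<^esub> r) w =
    (\<Oplus>i\<in>{..?n}. (\<Oplus>j\<in>{..i}. p (take j (take i w)) \<otimes> q (drop j (take i w))) \<otimes> r (drop i w))"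
    unfolding free_algebra_simps by (intro finsum_cong') (auto simp: min_def)
  also have "\<dots> = (\<Oplus>i\<in>{..?n}. \<Oplus>j\<in>{..i}. ?f j (i - j))"
    by (intro finsum_cong' refl)
      (auto simp: finsum_ldistr m_assoc min_def take_drop intro!: finsum_cong')
  also have "\<dots> = (\<Oplus>j\<in>{..?n}. \<Oplus>k\<in>{..?n - j}. ?f j k)"
    by (rule finsum_triangle) simp
  also have "\<dots> = (p \<otimes>\<^bsub>free_algebra R X\<^esub> (q \<otimes>\<^bsub>free_algebra R X\<^esub> r)) w"
    unfolding free_algebra_simps
    by (intro finsum_cong' refl) (auto simp: finsum_rdistr add.commute)
  finally show "(p \<otimes>\<^bsub>free_algebra R X\<^esub> q \<otimes>\<^bsub>free_algebra R X\<^esub> r) w =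
    (p \<otimes>\<^bsub>free_algebra R X\<^esub> (q \<otimes>\<^bsub>free_algebra R X\<^esub> r)) w" .
qed

lemma free_algebra_one_mult:
  assumes p: "p \<in> carrier (free_algebra R X)"
  shows "\<one>\<^bsub>free_algebra R X\<^esub> \<otimes>\<^bsub>free_algebra R X\<^esub> p = p"
    and "p \<otimes>\<^bsub>free_algebra R X\<^esub> \<one>\<^bsub>free_algebra R X\<^esub> = p"
proof -
  note [simp] = free_algebra_coeff_closed[OF p]
  have "(\<Oplus>i\<in>{..length w}. (if take i w = [] then \<one> else \<zero>) \<otimes> p (drop i w)) = p w" for w
  proof -
    have "(\<Oplus>i\<in>{..length w}. (if take i w = [] then \<one> else \<zero>) \<otimes> p (drop i w)) =
      (\<Oplus>i\<in>{..length w}. if 0 = i then p (drop i w) else \<zero>)"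
      by (intro finsum_cong') auto
    also have "\<dots> = p w"
      by (subst finsum_singleton) auto
    finally show ?thesis .
  qed
  then show "\<one>\<^bsub>free_algebra R X\<^esub> \<otimes>\<^bsub>free_algebra R X\<^esub> p = p"
    unfolding free_algebra_simps by simp
  have "(\<Oplus>i\<in>{..length w}. p (take i w) \<otimes> (if drop i w = [] then \<one> else \<zero>)) = p w" for w
  proof -
    have "(\<Oplus>i\<in>{..length w}. p (take i w) \<otimes> (if drop i w = [] then \<one> else \<zero>)) =
      (\<Oplus>i\<in>{..length w}. if length w = i then p (take i w) else \<zero>)"
      by (intro finsum_cong') auto
    also have "\<dots> = p w"
      by (subst finsum_singleton) auto
    finally show ?thesis .
  qed
  then show "p \<otimes>\<^bsub>free_algebra R X\<^esub> \<one>\<^bsub>free_algebra R X\<^esub> = p"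
    unfolding free_algebra_simps by simp
qed

lemma free_algebra_abelian_group: "abelian_group (free_algebra R X)"
proof (rule abelian_groupI)
  fix p assume p: "p \<in> carrier (free_algebra R X)"
  have "(\<lambda>w. \<ominus> p w) \<in> carrier (free_algebra R X)"
    using p by (auto simp: free_algebra_simps)
  moreover have "(\<lambda>w. \<ominus> p w) \<oplus>\<^bsub>free_algebra R X\<^esub> p = \<zero>\<^bsub>free_algebra R X\<^esub>"
    using p by (simp add: free_algebra_simps l_neg)
  ultimately show "\<exists>q\<in>carrier (free_algebra R X). q \<oplus>\<^bsub>free_algebra R X\<^esub> p = \<zero>\<^bsub>free_algebra R X\<^esub>"
    by blast
qed (simp_all add: free_algebra_add_closed, auto simp: free_algebra_simps a_ac)

lemma free_algebra_ring: "ring (free_algebra R X)"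
proof (intro ringI free_algebra_abelian_group)
  show "monoid (free_algebra R X)"
  proof (rule monoidI)
    show "\<one>\<^bsub>free_algebra R X\<^esub> \<in> carrier (free_algebra R X)"
      by (auto simp: free_algebra_simps)
  qed (simp_all add: free_algebra_mult_closed free_algebra_mult_assoc free_algebra_one_mult)
  fix p q r
  assume pqr: "p \<in> carrier (free_algebra R X)" "q \<in> carrier (free_algebra R X)"
    "r \<in> carrier (free_algebra R X)"
  note [simp] = pqr[THEN free_algebra_coeff_closed]
  show "(p \<oplus>\<^bsub>free_algebra R X\<^esub> q) \<otimes>\<^bsub>free_algebra R X\<^esub> r =
    p \<otimes>\<^bsub>free_algebra R X\<^esub> r \<oplus>\<^bsub>free_algebra R X\<^esub> q \<otimes>\<^bsub>free_algebra R X\<^esub> r"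
    unfolding free_algebra_simps by (rule ext) (simp add: l_distr finsum_addf Pi_def)
  show "r \<otimes>\<^bsub>free_algebra R X\<^esub> (p \<oplus>\<^bsub>free_algebra R X\<^esub> q) =
    r \<otimes>\<^bsub>free_algebra R X\<^esub> p \<oplus>\<^bsub>free_algebra R X\<^esub> r \<otimes>\<^bsub>free_algebra R X\<^esub> q"
    unfolding free_algebra_simps by (rule ext) (simp add: r_distr finsum_addf Pi_def)
qed

lemma free_algebra_module: "module R (free_algebra R X)"
  by (intro moduleI cring_axioms free_algebra_abelian_group free_algebra_smult_closed)
    (auto simp: free_algebra_simps l_distr r_distr m_assoc)

end


section \<open>Opposite algebras\<close>

lemma opposite_algebra_simps [simp]:
  "carrier (opposite_algebra A) = carrier A"
  "x \<otimes>\<^bsub>opposite_algebra A\<^esub> y = y \<otimes>\<^bsub>A\<^esub> x"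
  "\<one>\<^bsub>opposite_algebra A\<^esub> = \<one>\<^bsub>A\<^esub>"
  "\<zero>\<^bsub>opposite_algebra A\<^esub> = \<zero>\<^bsub>A\<^esub>"
  "add (opposite_algebra A) = add A"
  "a \<odot>\<^bsub>opposite_algebra A\<^esub> x = a \<odot>\<^bsub>A\<^esub> x"
  by (simp_all add: opposite_algebra_def)

lemma opposite_opposite_algebra: "opposite_algebra (opposite_algebra A) = A"
  by (simp add: opposite_algebra_def)

lemma ring_opposite_algebra:
  assumes "ring A"
  shows "ring (opposite_algebra A)"
proof -
  interpret ring A by fact
  show ?thesis
  proof (rule ringI)
    show "abelian_group (opposite_algebra A)"
      using a_comm_group by (intro comm_group_abelian_groupI) simp
    show "Group.monoid (opposite_algebra A)"
      by (rule monoidI) (auto simp: m_assoc)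
  qed (auto simp: l_distr r_distr)
qed

lemma unital_algebra_opposite_algebra:
  assumes "unital_algebra K A"
  shows "unital_algebra K (opposite_algebra A)"
proof -
  interpret unital_algebra K A by fact
  have A: "ring A"
    using assms by (rule unital_algebra.axioms)
  have "module K (opposite_algebra A)"
    using ring.is_abelian_group[OF ring_opposite_algebra[OF A]]
    by (intro moduleI R.cring_axioms) (auto simp: smult_l_distr smult_r_distr smult_assoc1)
  then show ?thesis
    unfolding unital_algebra_def unital_algebra_axioms_def
    using ring_opposite_algebra[OF A] one_neq_zero
    by (auto simp: smult_assoc_left smult_assoc_right)
qed

lemma ideal_opposite_algebra:
  assumes "ideal I A"
  shows "ideal I (opposite_algebra A)"
proof -
  interpret ideal I A by fact
  show ?thesis
    using a_subgroup
    by (intro idealI ring_opposite_algebra ring_axioms) (auto simp: I_l_closed I_r_closed)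
qed

lemma genideal_opposite_algebra: "genideal (opposite_algebra A) S = genideal A S"
proof -
  have "ideal I (opposite_algebra A) \<longleftrightarrow> ideal I A" for I
    using ideal_opposite_algebra[of I A] ideal_opposite_algebra[of I "opposite_algebra A"]
    by (auto simp: opposite_opposite_algebra)
  then show ?thesis
    by (simp add: genideal_def)
qed


section \<open>Quotient algebras\<close>

lemma quotient_algebra_simps:
  "carrier (quotient_algebra A I) = carrier (A Quot I)"
  "mult (quotient_algebra A I) = mult (A Quot I)"
  "one (quotient_algebra A I) = one (A Quot I)"
  "zero (quotient_algebra A I) = zero (A Quot I)"
  "add (quotient_algebra A I) = add (A Quot I)"
  "a \<odot>\<^bsub>quotient_algebra A I\<^esub> C = (\<Union>x\<in>C. I +>\<^bsub>A\<^esub> (a \<odot>\<^bsub>A\<^esub> x))"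
  by (simp_all add: quotient_algebra_def ring.defs module.defs)

lemma ring_quotient_algebra:
  assumes "ideal I A"
  shows "ring (quotient_algebra A I)"
proof -
  interpret Q: ring "A Quot I"
    using assms by (rule ideal.quotient_is_ring)
  show ?thesis
  proof (rule ringI)
    show "abelian_group (quotient_algebra A I)"
      using abelian_groupE[OF Q.is_abelian_group]
      by (intro abelian_groupI) (simp_all add: quotient_algebra_simps)
    show "Group.monoid (quotient_algebra A I)"
      by (rule monoidI) (simp_all add: quotient_algebra_simps Q.m_assoc)
  qed (simp_all add: quotient_algebra_simps Q.l_distr Q.r_distr)
qed

lemma quotient_opposite_algebra:
  "quotient_algebra (opposite_algebra A) I = opposite_algebra (quotient_algebra A I)"
proof -
  have coset: "a_r_coset (opposite_algebra A) = a_r_coset A"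
    by (simp add: a_r_coset_def)
  have "rcoset_mult (opposite_algebra A) I = (\<lambda>C D. rcoset_mult A I D C)"
    unfolding rcoset_mult_def coset by (auto simp: fun_eq_iff)
  then show ?thesis
    by (simp add: quotient_algebra_def ring.defs module.defs FactRing_def A_RCOSETS_def
        set_add_def coset) (simp add: opposite_algebra_def)
qed

text \<open>The preimage of an ideal under a homomorphism is an ideal, so any homomorphism sends the
  ideal generated by a set into the ideal generated by its image. Applied to the isomorphism and
  to its inverse, this gives the two inclusions.\<close>

lemma ring_iso_image_genideal:
  assumes A: "ring A" and B: "ring B" and f: "f \<in> ring_iso A B" and S: "S \<subseteq> carrier A"
  shows "f ` genideal A S = genideal B (f ` S)"
proof
  have image_subset: "f ` genideal A S \<subseteq> genideal B (f ` S)"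
    if A: "ring A" and B: "ring B" and f: "f \<in> ring_hom A B" and S: "S \<subseteq> carrier A"
    for A :: "('x, 'y) ring_scheme" and B :: "('z, 'w) ring_scheme" and f S
  proof -
    interpret f: ring_hom_ring A B f
      using A B f by (rule ring_hom_ringI2)
    have fS: "f ` S \<subseteq> carrier B"
      using S by auto
    have "ideal {x \<in> carrier A. f x \<in> genideal B (f ` S)} A"
      using fS by (intro f.ideal_vimage f.S.genideal_ideal)
    moreover have "S \<subseteq> {x \<in> carrier A. f x \<in> genideal B (f ` S)}"
      using S f.S.genideal_self[OF fS] by auto
    ultimately show ?thesis
      using f.R.genideal_minimal by blast
  qed
  from f have hom: "f \<in> ring_hom A B" and bij: "bij_betw f (carrier A) (carrier B)"
    by (auto simp: ring_iso_def)
  let ?g = "inv_into (carrier A) f"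
  have g: "?g \<in> ring_hom B A"
    using ring_iso_set_sym[OF A f] by (simp add: ring_iso_def)
  have fS: "f ` S \<subseteq> carrier B"
    using S bij by (auto simp: bij_betw_def)
  show "f ` genideal A S \<subseteq> genideal B (f ` S)"
    by (rule image_subset[OF A B hom S])
  have "?g ` genideal B (f ` S) \<subseteq> genideal A (?g ` f ` S)"
    by (rule image_subset[OF B A g fS])
  moreover have "?g ` f ` S = S"
    using S bij by (simp add: bij_betw_def inv_into_image_cancel)
  moreover have "f ` ?g ` genideal B (f ` S) = genideal B (f ` S)"
    using bij additive_subgroup.a_subset[OF ideal.axioms(1)[OF ring.genideal_ideal[OF B fS]]]
    by (simp add: bij_betw_def image_inv_into_cancel)
  ultimately show "genideal B (f ` S) \<subseteq> f ` genideal A S"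
    by (metis image_mono)
qed

text \<open>Elements of the quotient are cosets, that is subsets of \<^verbatim>\<open>A\<close>, and the induced map is simply
  the image under \<^verbatim>\<open>f\<close>. Injectivity on cosets is then inherited from \<^verbatim>\<open>f\<close>, no representatives are
  chosen, and compatibility with the operations holds because each operation on cosets is a union
  over all representatives.\<close>

lemma algebra_iso_quotient:
  fixes A :: "('k, 'a) module" and B :: "('k, 'b) module"
  assumes A: "ring A" and KA: "module K A" and B: "ring B"
    and f: "f \<in> algebra_iso K A B" and S: "S \<subseteq> carrier A"
  shows "(`) f \<in> algebra_iso K (quotient_algebra A (genideal A S)) (quotient_algebra B (genideal B (f ` S)))"
proof -
  define I where "I = genideal A S"
  have iso: "f \<in> ring_iso A B"
    and smult: "\<And>a x. a \<in> carrier K \<Longrightarrow> x \<in> carrier A \<Longrightarrow> f (a \<odot>\<^bsub>A\<^esub> x) = a \<odot>\<^bsub>B\<^esub> f x"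
    using f by (auto simp: algebra_iso_def)
  note f_simps = ring_iso_memE(2-4)[OF iso]
  have bij: "bij_betw f (carrier A) (carrier B)"
    using iso by (simp add: ring_iso_def)
  have fI: "f ` I = genideal B (f ` S)"
    unfolding I_def by (rule ring_iso_image_genideal[OF A B iso S])
  interpret A: ring A by fact
  interpret I: ideal I A
    unfolding I_def using S by (rule A.genideal_ideal)
  have sub: "I \<subseteq> carrier A"
    by (rule I.a_subset)
  have coset_image: "f ` (I +>\<^bsub>A\<^esub> x) = f ` I +>\<^bsub>B\<^esub> f x" if "x \<in> carrier A" for x
    using that sub f_simps(2) by (force simp: a_r_coset_def')
  have cosets: "a_rcosets\<^bsub>A\<^esub> I \<subseteq> Pow (carrier A)"
    using sub by (auto simp: A_RCOSETS_def' a_r_coset_def')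
  have mult: "f ` rcoset_mult A I C D = rcoset_mult B (f ` I) (f ` C) (f ` D)"
    if "C \<subseteq> carrier A" "D \<subseteq> carrier A" for C D
    using that unfolding rcoset_mult_def
    by (simp add: image_UN subset_iff coset_image f_simps cong: SUP_cong_simp)
  have add: "f ` (C <+>\<^bsub>A\<^esub> D) = f ` C <+>\<^bsub>B\<^esub> f ` D"
    if "C \<subseteq> carrier A" "D \<subseteq> carrier A" for C D
    using that unfolding set_add_def'
    by (simp add: image_UN subset_iff f_simps cong: SUP_cong_simp)
  have scal: "f ` (\<Union>x\<in>C. I +>\<^bsub>A\<^esub> (a \<odot>\<^bsub>A\<^esub> x)) = (\<Union>y\<in>f ` C. f ` I +>\<^bsub>B\<^esub> (a \<odot>\<^bsub>B\<^esub> y))"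
    if "a \<in> carrier K" "C \<subseteq> carrier A" for a C
    using that module.smult_closed[OF KA]
    by (simp add: image_UN subset_iff coset_image smult cong: SUP_cong_simp)
  have image: "(`) f ` (a_rcosets\<^bsub>A\<^esub> I) = a_rcosets\<^bsub>B\<^esub> (f ` I)"
  proof -
    have "(`) f ` (a_rcosets\<^bsub>A\<^esub> I) = (\<Union>x\<in>carrier A. {f ` I +>\<^bsub>B\<^esub> f x})"
      by (simp add: A_RCOSETS_def' image_UN coset_image)
    also have "\<dots> = (\<Union>y\<in>f ` carrier A. {f ` I +>\<^bsub>B\<^esub> y})"
      by simp
    also have "\<dots> = a_rcosets\<^bsub>B\<^esub> (f ` I)"
      using bij by (simp only: A_RCOSETS_def' bij_betw_def)
    finally show ?thesis .
  qed
  have inj: "inj_on ((`) f) (a_rcosets\<^bsub>A\<^esub> I)"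
    using bij cosets by (meson bij_betw_def inj_on_image_Pow inj_on_subset)
  have "(`) f \<in> ring_iso (quotient_algebra A I) (quotient_algebra B (f ` I))"
  proof (rule ring_iso_memI)
    show "bij_betw ((`) f) (carrier (quotient_algebra A I)) (carrier (quotient_algebra B (f ` I)))"
      using inj image by (simp add: bij_betw_def quotient_algebra_simps FactRing_def)
    show "f ` \<one>\<^bsub>quotient_algebra A I\<^esub> = \<one>\<^bsub>quotient_algebra B (f ` I)\<^esub>"
      by (simp add: quotient_algebra_simps FactRing_def coset_image f_simps ring_iso_memE(5)[OF iso])
    fix C assume "C \<in> carrier (quotient_algebra A I)"
    then have C: "C \<in> a_rcosets\<^bsub>A\<^esub> I"
      by (simp add: quotient_algebra_simps FactRing_def)
    then show "f ` C \<in> carrier (quotient_algebra B (f ` I))"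
      using image by (auto simp: quotient_algebra_simps FactRing_def)
    fix D assume "D \<in> carrier (quotient_algebra A I)"
    then have D: "D \<in> a_rcosets\<^bsub>A\<^esub> I"
      by (simp add: quotient_algebra_simps FactRing_def)
    have CD: "C \<subseteq> carrier A" "D \<subseteq> carrier A"
      using C D cosets by auto
    show "f ` (C \<otimes>\<^bsub>quotient_algebra A I\<^esub> D) = f ` C \<otimes>\<^bsub>quotient_algebra B (f ` I)\<^esub> f ` D"
      using mult[OF CD] by (simp add: quotient_algebra_simps FactRing_def)
    show "f ` (C \<oplus>\<^bsub>quotient_algebra A I\<^esub> D) = f ` C \<oplus>\<^bsub>quotient_algebra B (f ` I)\<^esub> f ` D"
      using add[OF CD] by (simp add: quotient_algebra_simps FactRing_def)
  qed
  then show ?thesis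
    unfolding fI[symmetric] I_def[symmetric] algebra_iso_def
  proof (intro CollectI conjI ballI)
    fix a C assume "a \<in> carrier K" and "C \<in> carrier (quotient_algebra A I)"
    then show "f ` (a \<odot>\<^bsub>quotient_algebra A I\<^esub> C) = a \<odot>\<^bsub>quotient_algebra B (f ` I)\<^esub> f ` C"
      using scal[of a C] cosets by (simp add: quotient_algebra_simps FactRing_def subset_iff)
  qed
qed


section \<open>Word reversal\<close>

text \<open>In terms of formal sums of words, \<^verbatim>\<open>x\<^sub>1\<dots>x\<^sub>n \<mapsto> \<tau> x\<^sub>n\<dots>\<tau> x\<^sub>1\<close>, extended linearly: the
  coefficient function is composed with the inverse of that map, which is the map itself since
  \<^verbatim>\<open>\<tau>\<close> will be an involution of \<^verbatim>\<open>X\<close>. The explicit zero matters when \<^verbatim>\<open>\<tau>\<close> sends letters outside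
  \<^verbatim>\<open>X\<close> into \<^verbatim>\<open>X\<close>.\<close>

definition reverse_words ::
  "('k, 'c) ring_scheme \<Rightarrow> 'x set \<Rightarrow> ('x \<Rightarrow> 'x) \<Rightarrow> ('x list \<Rightarrow> 'k) \<Rightarrow> ('x list \<Rightarrow> 'k)" where
  "reverse_words K X \<tau> p = (\<lambda>w. if set w \<subseteq> X then p (rev (map \<tau> w)) else \<zero>\<^bsub>K\<^esub>)"

locale letter_involution = cring R for R (structure) +
  fixes X :: "'x set" and \<tau> :: "'x \<Rightarrow> 'x"
  assumes letter_closed: "x \<in> X \<Longrightarrow> \<tau> x \<in> X"
    and letter_involution: "x \<in> X \<Longrightarrow> \<tau> (\<tau> x) = x"
begin

abbreviation "F \<equiv> free_algebra R X"
abbreviation "\<theta> \<equiv> reverse_words R X \<tau>"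

lemma rev_map_involution:
  assumes "set w \<subseteq> X"
  shows "set (rev (map \<tau> w)) \<subseteq> X" and "rev (map \<tau> (rev (map \<tau> w))) = w"
proof -
  show "set (rev (map \<tau> w)) \<subseteq> X"
    using assms letter_closed by auto
  have "map (\<tau> \<circ> \<tau>) w = w"
    using assms letter_involution by (intro map_idI) auto
  then show "rev (map \<tau> (rev (map \<tau> w))) = w"
    by (simp add: rev_map)
qed

lemma reverse_words_closed:
  assumes p: "p \<in> carrier F"
  shows "\<theta> p \<in> carrier F"
proof -
  have "w \<in> (\<lambda>w. rev (map \<tau> w)) ` {w. p w \<noteq> \<zero>}" if "\<theta> p w \<noteq> \<zero>" for w
  proof (rule image_eqI)
    have "set w \<subseteq> X"
      using that by (auto simp: reverse_words_def split: if_splits)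
    then show "w = rev (map \<tau> (rev (map \<tau> w)))"
      by (simp only: rev_map_involution(2))
    show "rev (map \<tau> w) \<in> {w. p w \<noteq> \<zero>}"
      using that by (simp add: reverse_words_def split: if_splits)
  qed
  then have "{w. \<theta> p w \<noteq> \<zero>} \<subseteq> (\<lambda>w. rev (map \<tau> w)) ` {w. p w \<noteq> \<zero>}"
    by blast
  then have "finite {w. \<theta> p w \<noteq> \<zero>}"
    by (rule finite_subset) (use p in \<open>simp add: free_algebra_simps\<close>)
  then show ?thesis
    using p by (auto simp: free_algebra_simps reverse_words_def split: if_splits)
qed

lemma reverse_words_involution:
  assumes "p \<in> carrier F"
  shows "\<theta> (\<theta> p) = p"
  using assms rev_map_involution free_algebra_support[OF assms]
  by (auto simp: reverse_words_def fun_eq_iff)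

lemma reverse_words_word:
  assumes "set u \<subseteq> X"
  shows "\<theta> (word R u) = word R (rev (map \<tau> u))"
  using assms rev_map_involution
  by (auto simp: reverse_words_def word_def fun_eq_iff)

lemma reverse_words_mult:
  assumes p: "p \<in> carrier F" and q: "q \<in> carrier F"
  shows "\<theta> (p \<otimes>\<^bsub>F\<^esub> q) = \<theta> q \<otimes>\<^bsub>F\<^esub> \<theta> p"
proof
  fix w
  note [simp] = free_algebra_coeff_closed[OF p] free_algebra_coeff_closed[OF q]
  note \<theta>pq = p[THEN reverse_words_closed] q[THEN reverse_words_closed]
  note [simp] = free_algebra_coeff_closed[OF \<theta>pq(1)] free_algebra_coeff_closed[OF \<theta>pq(2)]
  show "\<theta> (p \<otimes>\<^bsub>F\<^esub> q) w = (\<theta> q \<otimes>\<^bsub>F\<^esub> \<theta> p) w"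
  proof (cases "set w \<subseteq> X")
    case False
    then show ?thesis
      using free_algebra_support[OF free_algebra_mult_closed[OF \<theta>pq(2,1)]]
      by (simp add: reverse_words_def)
  next
    case True
    let ?n = "length w"
    have letters: "set (take i w) \<subseteq> X" "set (drop i w) \<subseteq> X" for i
      using True set_take_subset[of i w] set_drop_subset[of i w] by auto
    \<comment> \<open>Cutting the reversed word after \<^verbatim>\<open>i\<close> letters cuts \<^verbatim>\<open>w\<close> before its last \<^verbatim>\<open>i\<close> letters, so
      the cuts of \<^verbatim>\<open>w\<close> are enumerated from the right.\<close>
    have "\<theta> (p \<otimes>\<^bsub>F\<^esub> q) w =
      (\<Oplus>i\<in>{..?n}. p (take i (rev (map \<tau> w))) \<otimes> q (drop i (rev (map \<tau> w))))"
      using True by (simp add: reverse_words_def free_algebra_simps)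
    also have "\<dots> = (\<Oplus>i\<in>{..?n}. \<theta> q (take (?n - i) w) \<otimes> \<theta> p (drop (?n - i) w))"
      using letters
      by (intro finsum_cong') (auto simp: reverse_words_def take_rev drop_rev take_map drop_map m_comm)
    also have "\<dots> = (\<Oplus>i\<in>(\<lambda>i. ?n - i) ` {..?n}. \<theta> q (take i w) \<otimes> \<theta> p (drop i w))"
      by (intro finsum_reindex[symmetric]) (auto simp: inj_on_def)
    also have "(\<lambda>i. ?n - i) ` {..?n} = {..?n}"
    proof -
      have "i \<in> (\<lambda>i. ?n - i) ` {..?n}" if "i \<le> ?n" for i
        using that by (intro image_eqI[of _ _ "?n - i"]) auto
      then show ?thesis
        by auto
    qed
    finally show ?thesis
      by (simp add: free_algebra_simps)
  qed
qed

lemma reverse_words_algebra_iso: "\<theta> \<in> algebra_iso R F (opposite_algebra F)"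
proof -
  have "\<theta> \<in> ring_iso F (opposite_algebra F)"
  proof (rule ring_iso_memI)
    show "\<theta> \<one>\<^bsub>F\<^esub> = \<one>\<^bsub>opposite_algebra F\<^esub>"
      by (auto simp: free_algebra_simps reverse_words_def)
    show "bij_betw \<theta> (carrier F) (carrier (opposite_algebra F))"
      by (rule bij_betw_byWitness[where f' = \<theta>])
        (auto simp: reverse_words_involution reverse_words_closed)
  qed (simp_all add: reverse_words_mult reverse_words_closed,
      auto simp: free_algebra_simps reverse_words_def fun_eq_iff)
  then show ?thesis
    by (auto simp: algebra_iso_def free_algebra_simps reverse_words_def fun_eq_iff)
qed

end


section \<open>The opposite of a twisted partial group algebra\<close>

text \<open>For \<^verbatim>\<open>\<Gamma>' g = \<Gamma> (g\<inverse>)\<close> in the opposite algebra, each condition at \<^verbatim>\<open>(g, h)\<close> is a condition on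
  \<^verbatim>\<open>\<Gamma>\<close> at \<^verbatim>\<open>(h\<inverse>, g\<inverse>)\<close>; the one with \<^verbatim>\<open>\<Gamma> (g\<inverse>)\<close> on the left and the one with \<^verbatim>\<open>\<Gamma> (h\<inverse>)\<close> on the
  right change places.\<close>

lemma dual_factor_set_pm:
  fixes K :: "('k, 'c) ring_scheme"
  assumes G: "group G" and \<rho>: "\<rho> \<in> pm TYPE('r) K G"
  shows "dual_factor_set G \<rho> \<in> pm TYPE('r) K G"
proof -
  interpret group G by fact
  obtain R :: "('k, 'r) module" and \<Gamma>
    where R: "unital_algebra K R" and \<Gamma>: "is_factor_set K G R \<Gamma> \<rho>"
    using \<rho> by (auto simp: pm_def)
  interpret R: ring R
    using R by (rule unital_algebra.axioms)
  let ?\<Gamma>' = "\<lambda>g. \<Gamma> (inv\<^bsub>G\<^esub> g)"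
  note rep = \<Gamma>[unfolded is_factor_set_def partial_projective_rep_with_def]
  from rep have closed: "\<And>g. g \<in> carrier G \<Longrightarrow> \<Gamma> g \<in> carrier R"
    by auto
  have "is_factor_set K G (opposite_algebra R) ?\<Gamma>' (dual_factor_set G \<rho>)"
    unfolding is_factor_set_def partial_projective_rep_with_def
  proof (intro conjI ballI impI)
    show "?\<Gamma>' \<in> carrier G \<rightarrow> carrier (opposite_algebra R)"
      using closed by auto
    show "dual_factor_set G \<rho> \<in> carrier G \<rightarrow> carrier G \<rightarrow> carrier K"
      using rep by (auto simp: dual_factor_set_def Pi_iff)
    show "?\<Gamma>' \<one>\<^bsub>G\<^esub> = \<one>\<^bsub>opposite_algebra R\<^esub>"
      using rep by simp
  next
    fix g h assume gh: "g \<in> carrier G" "h \<in> carrier G"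
    let ?g = "inv\<^bsub>G\<^esub> g" and ?h = "inv\<^bsub>G\<^esub> h"
    have inv_gh: "?g \<in> carrier G" "?h \<in> carrier G"
      using gh by auto
    have dual: "dual_factor_set G \<rho> g h = \<rho> ?h ?g"
      by (simp add: dual_factor_set_def)
    have prods: "inv\<^bsub>G\<^esub> (g \<otimes>\<^bsub>G\<^esub> h) = ?h \<otimes>\<^bsub>G\<^esub> ?g" "inv\<^bsub>G\<^esub> ?g = g" "inv\<^bsub>G\<^esub> ?h = h"
      using gh by (auto simp: inv_mult_group)
    note mem = closed[OF gh(1)] closed[OF gh(2)] closed[OF inv_gh(1)] closed[OF inv_gh(2)]
    from rep inv_gh have
      zero: "\<rho> ?h ?g = \<zero>\<^bsub>K\<^esub> \<longrightarrow> \<Gamma> (inv\<^bsub>G\<^esub> ?h) \<otimes>\<^bsub>R\<^esub> \<Gamma> (?h \<otimes>\<^bsub>G\<^esub> ?g) = \<zero>\<^bsub>R\<^esub> \<and>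
        \<Gamma> (?h \<otimes>\<^bsub>G\<^esub> ?g) \<otimes>\<^bsub>R\<^esub> \<Gamma> (inv\<^bsub>G\<^esub> ?g) = \<zero>\<^bsub>R\<^esub>"
      and left: "\<Gamma> (inv\<^bsub>G\<^esub> ?h) \<otimes>\<^bsub>R\<^esub> \<Gamma> ?h \<otimes>\<^bsub>R\<^esub> \<Gamma> ?g =
        \<rho> ?h ?g \<odot>\<^bsub>R\<^esub> (\<Gamma> (inv\<^bsub>G\<^esub> ?h) \<otimes>\<^bsub>R\<^esub> \<Gamma> (?h \<otimes>\<^bsub>G\<^esub> ?g))"
      and right: "\<Gamma> ?h \<otimes>\<^bsub>R\<^esub> \<Gamma> ?g \<otimes>\<^bsub>R\<^esub> \<Gamma> (inv\<^bsub>G\<^esub> ?g) =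
        \<rho> ?h ?g \<odot>\<^bsub>R\<^esub> (\<Gamma> (?h \<otimes>\<^bsub>G\<^esub> ?g) \<otimes>\<^bsub>R\<^esub> \<Gamma> (inv\<^bsub>G\<^esub> ?g))"
      and factor: "\<Gamma> ?h \<otimes>\<^bsub>R\<^esub> \<Gamma> ?g = \<zero>\<^bsub>R\<^esub> \<longrightarrow> \<rho> ?h ?g = \<zero>\<^bsub>K\<^esub>"
      by blast+
    show "?\<Gamma>' ?g \<otimes>\<^bsub>opposite_algebra R\<^esub> ?\<Gamma>' (g \<otimes>\<^bsub>G\<^esub> h) = \<zero>\<^bsub>opposite_algebra R\<^esub>"
      "?\<Gamma>' (g \<otimes>\<^bsub>G\<^esub> h) \<otimes>\<^bsub>opposite_algebra R\<^esub> ?\<Gamma>' ?h = \<zero>\<^bsub>opposite_algebra R\<^esub>"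
      if "dual_factor_set G \<rho> g h = \<zero>\<^bsub>K\<^esub>"
      using zero that by (simp_all add: dual prods)
    show "?\<Gamma>' ?g \<otimes>\<^bsub>opposite_algebra R\<^esub> ?\<Gamma>' g \<otimes>\<^bsub>opposite_algebra R\<^esub> ?\<Gamma>' h =
      dual_factor_set G \<rho> g h \<odot>\<^bsub>opposite_algebra R\<^esub>
        (?\<Gamma>' ?g \<otimes>\<^bsub>opposite_algebra R\<^esub> ?\<Gamma>' (g \<otimes>\<^bsub>G\<^esub> h))"
      using right mem by (simp add: dual prods R.m_assoc)
    show "?\<Gamma>' g \<otimes>\<^bsub>opposite_algebra R\<^esub> ?\<Gamma>' h \<otimes>\<^bsub>opposite_algebra R\<^esub> ?\<Gamma>' ?h =
      dual_factor_set G \<rho> g h \<odot>\<^bsub>opposite_algebra R\<^esub>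
        (?\<Gamma>' (g \<otimes>\<^bsub>G\<^esub> h) \<otimes>\<^bsub>opposite_algebra R\<^esub> ?\<Gamma>' ?h)"
      using left mem by (simp add: dual prods R.m_assoc)
    show "dual_factor_set G \<rho> g h = \<zero>\<^bsub>K\<^esub>"
      if "?\<Gamma>' g \<otimes>\<^bsub>opposite_algebra R\<^esub> ?\<Gamma>' h = \<zero>\<^bsub>opposite_algebra R\<^esub>"
      using factor that by (simp add: dual)
  qed
  then show ?thesis
    using unital_algebra_opposite_algebra[OF R] by (auto simp: pm_def)
qed

lemma twisted_relators_cases:
  assumes "r \<in> twisted_relators K G \<rho>"
  obtains
    (left_zero) g h where "g \<in> carrier G" "h \<in> carrier G" "\<rho> g h = \<zero>\<^bsub>K\<^esub>"
      "r = word K [inv\<^bsub>G\<^esub> g, g \<otimes>\<^bsub>G\<^esub> h]"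
  | (right_zero) g h where "g \<in> carrier G" "h \<in> carrier G" "\<rho> g h = \<zero>\<^bsub>K\<^esub>"
      "r = word K [g \<otimes>\<^bsub>G\<^esub> h, inv\<^bsub>G\<^esub> h]"
  | (left_twist) g h where "g \<in> carrier G" "h \<in> carrier G"
      "r = word K [inv\<^bsub>G\<^esub> g, g, h] \<ominus>\<^bsub>free_algebra K (carrier G)\<^esub>
        \<rho> g h \<odot>\<^bsub>free_algebra K (carrier G)\<^esub> word K [inv\<^bsub>G\<^esub> g, g \<otimes>\<^bsub>G\<^esub> h]"
  | (right_twist) g h where "g \<in> carrier G" "h \<in> carrier G"
      "r = word K [g, h, inv\<^bsub>G\<^esub> h] \<ominus>\<^bsub>free_algebra K (carrier G)\<^esub>
        \<rho> g h \<odot>\<^bsub>free_algebra K (carrier G)\<^esub> word K [g \<otimes>\<^bsub>G\<^esub> h, inv\<^bsub>G\<^esub> h]"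
  | (right_unit) g where "g \<in> carrier G"
      "r = word K [g, \<one>\<^bsub>G\<^esub>] \<ominus>\<^bsub>free_algebra K (carrier G)\<^esub> word K [g]"
  | (left_unit) g where "g \<in> carrier G"
      "r = word K [\<one>\<^bsub>G\<^esub>, g] \<ominus>\<^bsub>free_algebra K (carrier G)\<^esub> word K [g]"
  | (unit) "r = word K [\<one>\<^bsub>G\<^esub>] \<ominus>\<^bsub>free_algebra K (carrier G)\<^esub> \<one>\<^bsub>free_algebra K (carrier G)\<^esub>"
  using assms unfolding twisted_relators_def Let_def by (auto split: if_splits)

lemma twisted_relators_intros:
  assumes "g \<in> carrier G" and "h \<in> carrier G"
  shows "\<rho> g h = \<zero>\<^bsub>K\<^esub> \<Longrightarrow> word K [inv\<^bsub>G\<^esub> g, g \<otimes>\<^bsub>G\<^esub> h] \<in> twisted_relators K G \<rho>"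
    and "\<rho> g h = \<zero>\<^bsub>K\<^esub> \<Longrightarrow> word K [g \<otimes>\<^bsub>G\<^esub> h, inv\<^bsub>G\<^esub> h] \<in> twisted_relators K G \<rho>"
    and "word K [inv\<^bsub>G\<^esub> g, g, h] \<ominus>\<^bsub>free_algebra K (carrier G)\<^esub>
        \<rho> g h \<odot>\<^bsub>free_algebra K (carrier G)\<^esub> word K [inv\<^bsub>G\<^esub> g, g \<otimes>\<^bsub>G\<^esub> h] \<in> twisted_relators K G \<rho>"
    and "word K [g, h, inv\<^bsub>G\<^esub> h] \<ominus>\<^bsub>free_algebra K (carrier G)\<^esub>
        \<rho> g h \<odot>\<^bsub>free_algebra K (carrier G)\<^esub> word K [g \<otimes>\<^bsub>G\<^esub> h, inv\<^bsub>G\<^esub> h] \<in> twisted_relators K G \<rho>"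
    and "word K [g, \<one>\<^bsub>G\<^esub>] \<ominus>\<^bsub>free_algebra K (carrier G)\<^esub> word K [g] \<in> twisted_relators K G \<rho>"
    and "word K [\<one>\<^bsub>G\<^esub>, g] \<ominus>\<^bsub>free_algebra K (carrier G)\<^esub> word K [g] \<in> twisted_relators K G \<rho>"
    and "word K [\<one>\<^bsub>G\<^esub>] \<ominus>\<^bsub>free_algebra K (carrier G)\<^esub> \<one>\<^bsub>free_algebra K (carrier G)\<^esub>
        \<in> twisted_relators K G \<rho>"
  unfolding twisted_relators_def Let_def
        apply (rule UnI1, rule UnI1, rule UN_I[OF assms(1)], rule UN_I[OF assms(2)], rule UnI1, simp)
       apply (rule UnI1, rule UnI1, rule UN_I[OF assms(1)], rule UN_I[OF assms(2)], rule UnI1, simp)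
      apply (rule UnI1, rule UnI1, rule UN_I[OF assms(1)], rule UN_I[OF assms(2)], rule UnI2, simp)
     apply (rule UnI1, rule UnI1, rule UN_I[OF assms(1)], rule UN_I[OF assms(2)], rule UnI2, simp)
    apply (rule UnI1, rule UnI2, rule UN_I[OF assms(1)], simp)
   apply (rule UnI1, rule UnI2, rule UN_I[OF assms(1)], simp)
  apply (rule UnI2, simp)
  done

lemma twisted_relators_cong:
  assumes "\<And>g h. g \<in> carrier G \<Longrightarrow> h \<in> carrier G \<Longrightarrow> \<rho> g h = \<rho>' g h"
  shows "twisted_relators K G \<rho> = twisted_relators K G \<rho>'"
  unfolding twisted_relators_def using assms by (simp cong: SUP_cong_simp)

locale twist = K?: cring K + G?: group G
  for K :: "('k, 'c) ring_scheme" and G :: "('g, 'b) monoid_scheme" +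
  fixes \<rho> :: "'g \<Rightarrow> 'g \<Rightarrow> 'k"
  assumes twist_closed: "g \<in> carrier G \<Longrightarrow> h \<in> carrier G \<Longrightarrow> \<rho> g h \<in> carrier K"
begin

sublocale letter_involution K "carrier G" "m_inv G"
  by unfold_locales auto

lemma twist_dual: "twist K G (dual_factor_set G \<rho>)"
  by unfold_locales (simp add: dual_factor_set_def twist_closed)

lemma twisted_relators_closed: "twisted_relators K G \<rho> \<subseteq> carrier F"
proof
  interpret F: ring F
    by (rule free_algebra_ring)
  fix r assume "r \<in> twisted_relators K G \<rho>"
  then show "r \<in> carrier F"
    by (cases rule: twisted_relators_cases)
      (auto intro!: F.minus_closed free_algebra_word_closed free_algebra_smult_closed twist_closed)
qed

text \<open>For example \<^verbatim>\<open>[g\<inverse>][g][h]\<close> becomes \<^verbatim>\<open>[h\<inverse>][g\<inverse>][g]\<close> and \<^verbatim>\<open>[g\<inverse>][gh]\<close> becomes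
  \<^verbatim>\<open>[h\<inverse>g\<inverse>][g]\<close>: the left relator of \<^verbatim>\<open>\<rho>\<close> at \<^verbatim>\<open>(g, h)\<close> turns into the right relator of the dual
  twist at \<^verbatim>\<open>(h\<inverse>, g\<inverse>)\<close>, where the dual twist takes the value \<^verbatim>\<open>\<rho> g h\<close>.\<close>

lemma reverse_words_twisted_relators_subset:
  "\<theta> ` twisted_relators K G \<rho> \<subseteq> twisted_relators K G (dual_factor_set G \<rho>)"
proof (rule image_subsetI)
  interpret F: ring F
    by (rule free_algebra_ring)
  have \<theta>: "\<theta> \<in> ring_hom F (opposite_algebra F)"
    and \<theta>_smult: "\<And>a p. a \<in> carrier K \<Longrightarrow> p \<in> carrier F \<Longrightarrow> \<theta> (a \<odot>\<^bsub>F\<^esub> p) = a \<odot>\<^bsub>F\<^esub> \<theta> p"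
    using reverse_words_algebra_iso by (auto simp: algebra_iso_def ring_iso_def)
  interpret \<theta>: ring_hom_ring F "opposite_algebra F" \<theta>
    by (intro ring_hom_ringI2 ring_opposite_algebra F.ring_axioms \<theta>)
  have \<theta>_minus: "\<theta> (p \<ominus>\<^bsub>F\<^esub> q) = \<theta> p \<ominus>\<^bsub>F\<^esub> \<theta> q" if "p \<in> carrier F" "q \<in> carrier F" for p q
    \<comment> \<open>The first step leaves a negative in the opposite algebra, which has the same addition.\<close>
    using that by (simp add: a_minus_def) (simp add: a_inv_def)
  have words: "word K u \<in> carrier F" if "set u \<subseteq> carrier G" for u
    using that by (rule free_algebra_word_closed)
  fix r assume "r \<in> twisted_relators K G \<rho>"
  then show "\<theta> r \<in> twisted_relators K G (dual_factor_set G \<rho>)"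
  proof (cases rule: twisted_relators_cases)
    case (left_zero g h)
    then show ?thesis
      using twisted_relators_intros(2)[of "inv\<^bsub>G\<^esub> h" G "inv\<^bsub>G\<^esub> g" "dual_factor_set G \<rho>" K]
      by (simp add: dual_factor_set_def reverse_words_word inv_mult_group)
  next
    case (right_zero g h)
    then show ?thesis
      using twisted_relators_intros(1)[of "inv\<^bsub>G\<^esub> h" G "inv\<^bsub>G\<^esub> g" "dual_factor_set G \<rho>" K]
      by (simp add: dual_factor_set_def reverse_words_word inv_mult_group)
  next
    case (left_twist g h)
    then show ?thesis
      using twisted_relators_intros(4)[of "inv\<^bsub>G\<^esub> h" G "inv\<^bsub>G\<^esub> g" K "dual_factor_set G \<rho>"]
      by (simp add: dual_factor_set_def reverse_words_word inv_mult_group \<theta>_minus \<theta>_smult words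
          free_algebra_smult_closed twist_closed)
  next
    case (right_twist g h)
    then show ?thesis
      using twisted_relators_intros(3)[of "inv\<^bsub>G\<^esub> h" G "inv\<^bsub>G\<^esub> g" K "dual_factor_set G \<rho>"]
      by (simp add: dual_factor_set_def reverse_words_word inv_mult_group \<theta>_minus \<theta>_smult words
          free_algebra_smult_closed twist_closed)
  next
    case (right_unit g)
    then show ?thesis
      using twisted_relators_intros(6)[of "inv\<^bsub>G\<^esub> g" G "inv\<^bsub>G\<^esub> g" K "dual_factor_set G \<rho>"]
      by (simp add: reverse_words_word \<theta>_minus words)
  next
    case (left_unit g)
    then show ?thesis
      using twisted_relators_intros(5)[of "inv\<^bsub>G\<^esub> g" G "inv\<^bsub>G\<^esub> g" K "dual_factor_set G \<rho>"]
      by (simp add: reverse_words_word \<theta>_minus words)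
  next
    case unit
    then show ?thesis
      using twisted_relators_intros(7)[of "\<one>\<^bsub>G\<^esub>" G "\<one>\<^bsub>G\<^esub>" K "dual_factor_set G \<rho>"] \<theta>.hom_one
      by (simp add: reverse_words_word \<theta>_minus words)
  qed
qed

text \<open>Both \<^verbatim>\<open>\<theta>\<close> and the passage to the dual twist are involutions, so the inclusion for \<^verbatim>\<open>\<rho>\<close> and
  the one for its dual combine to an equality.\<close>

lemma reverse_words_twisted_relators:
  "\<theta> ` twisted_relators K G (dual_factor_set G \<rho>) = twisted_relators K G \<rho>"
proof
  interpret dual: twist K G "dual_factor_set G \<rho>"
    by (rule twist_dual)
  have dual_dual: "twisted_relators K G (dual_factor_set G (dual_factor_set G \<rho>)) = twisted_relators K G \<rho>"
    by (rule twisted_relators_cong) (simp add: dual_factor_set_def)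
  show sub: "\<theta> ` twisted_relators K G (dual_factor_set G \<rho>) \<subseteq> twisted_relators K G \<rho>"
    using dual.reverse_words_twisted_relators_subset dual_dual by simp
  show "twisted_relators K G \<rho> \<subseteq> \<theta> ` twisted_relators K G (dual_factor_set G \<rho>)"
  proof
    fix r assume r: "r \<in> twisted_relators K G \<rho>"
    then have "\<theta> r \<in> twisted_relators K G (dual_factor_set G \<rho>)"
      using reverse_words_twisted_relators_subset by blast
    moreover have "r = \<theta> (\<theta> r)"
      using r twisted_relators_closed reverse_words_involution by auto
    ultimately show "r \<in> \<theta> ` twisted_relators K G (dual_factor_set G \<rho>)"
      by blast
  qed
qed

lemma ring_twisted_partial_group_algebra: "ring (twisted_partial_group_algebra K G \<rho>)"
  unfolding twisted_partial_group_algebra_def Let_def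
  by (intro ring_quotient_algebra ring.genideal_ideal free_algebra_ring twisted_relators_closed)

lemma twisted_partial_group_algebra_dual_iso:
  "(`) \<theta> \<in> algebra_iso K (twisted_partial_group_algebra K G (dual_factor_set G \<rho>))
    (opposite_algebra (twisted_partial_group_algebra K G \<rho>))"
proof -
  interpret dual: twist K G "dual_factor_set G \<rho>"
    by (rule twist_dual)
  show ?thesis
    using algebra_iso_quotient[OF free_algebra_ring free_algebra_module
        ring_opposite_algebra[OF free_algebra_ring] reverse_words_algebra_iso
        dual.twisted_relators_closed]
    unfolding twisted_partial_group_algebra_def Let_def
    by (simp only: reverse_words_twisted_relators genideal_opposite_algebra quotient_opposite_algebra)
qed

end


section \<open>Module categories\<close>

text \<open>The record of a module over \<^verbatim>\<open>A\<close> stores the action as a function on \<^verbatim>\<open>carrier A\<close> whichever side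
  it is on, so this is an equality of categories.\<close>

lemma right_modules_opposite_algebra:
  "right_modules TYPE('m) (opposite_algebra A) = left_modules TYPE('m) A"
proof -
  have "additive_action (opposite_algebra A) = (additive_action A :: ('a, 'm) action \<Rightarrow> bool)"
    by (simp add: additive_action_def fun_eq_iff)
  moreover have "module_homs (opposite_algebra A) =
    (module_homs A :: ('a, 'm) action \<Rightarrow> ('a, 'm) action \<Rightarrow> ('m \<Rightarrow> 'm) set)"
    by (simp add: module_homs_def fun_eq_iff)
  ultimately show ?thesis
    unfolding right_modules_def left_modules_def module_cat_def right_module_def left_module_def
    by auto
qed

lemma category_module_cat:
  assumes "\<And>M. M \<in> \<M> \<Longrightarrow> additive_action A M"
  shows "category (module_cat A \<M>)"
proof -
  have closed: "x \<otimes>\<^bsub>M\<^esub> y \<in> carrier M" "a \<in> carrier A \<Longrightarrow> act M a x \<in> carrier M"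
    if "M \<in> \<M>" "x \<in> carrier M" "y \<in> carrier M" for M x y a
    using assms[OF that(1)] that(2,3) by (auto simp: additive_action_def)
  show ?thesis
    unfolding category_def module_cat_def cat.simps
  proof (intro conjI ballI)
    fix M N f assume "M \<in> \<M>" "N \<in> \<M>" and f: "f \<in> module_homs A M N"
    then show "compose (carrier M) f (\<lambda>m\<in>carrier M. m) = f"
      "compose (carrier M) (\<lambda>m\<in>carrier N. m) f = f"
      by (auto simp: module_homs_def compose_Id Id_compose PiE_iff Pi_iff)
  next
    fix L M N P f g h assume "f \<in> module_homs A L M"
    then show "compose (carrier L) (compose (carrier M) h g) f =
      compose (carrier L) h (compose (carrier L) g f)"
      by (intro compose_assoc[symmetric]) (auto simp: module_homs_def)
  qed (auto simp: module_homs_def closed compose_def PiE_iff)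
qed

lemma category_right_modules: "category (right_modules TYPE('m) A)"
  unfolding right_modules_def by (rule category_module_cat) (simp add: right_module_def)

text \<open>The new action is again undefined outside \<^verbatim>\<open>carrier B\<close>; this is what makes restriction along
  the inverse return the very same object.\<close>

definition restrict_scalars ::
  "('b, 'd) ring_scheme \<Rightarrow> ('b \<Rightarrow> 'a) \<Rightarrow> ('a, 'm) action \<Rightarrow> ('b, 'm) action" where
  "restrict_scalars B \<phi> M =
    \<lparr>carrier = carrier M, mult = mult M, one = one M, act = (\<lambda>b\<in>carrier B. act M (\<phi> b))\<rparr>"

lemma restrict_scalars_simps [simp]:
  "carrier (restrict_scalars B \<phi> M) = carrier M"
  "mult (restrict_scalars B \<phi> M) = mult M"
  "one (restrict_scalars B \<phi> M) = one M"
  "act (restrict_scalars B \<phi> M) = (\<lambda>b\<in>carrier B. act M (\<phi> b))"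
  by (simp_all add: restrict_scalars_def)

lemma right_module_restrict_scalars:
  assumes B: "ring B" and \<phi>: "\<phi> \<in> ring_hom B A" and M: "right_module A M"
  shows "right_module B (restrict_scalars B \<phi> M)"
proof -
  interpret B: ring B by fact
  note \<phi>_simps = ring_hom_closed[OF \<phi>] ring_hom_mult[OF \<phi>] ring_hom_add[OF \<phi>] ring_hom_one[OF \<phi>]
  have "comm_group M"
    using M by (simp add: right_module_def additive_action_def)
  then have "comm_group (restrict_scalars B \<phi> M)"
    by (intro comm_groupI) (use comm_groupE[of M] in simp_all)
  then show ?thesis
    using M unfolding right_module_def additive_action_def
    by (auto simp: \<phi>_simps PiE_iff Pi_iff)
qed

lemma is_functor_restrict_scalars:
  assumes B: "ring B" and \<phi>: "\<phi> \<in> ring_hom B A"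
  shows "is_functor (right_modules TYPE('m) A) (right_modules TYPE('m) B)
    (restrict_scalars B \<phi>) (\<lambda>M N f. f)"
  unfolding is_functor_def right_modules_def module_cat_def cat.simps
  using right_module_restrict_scalars[OF B \<phi>] ring_hom_closed[OF \<phi>]
  by (auto simp: module_homs_def)

lemma restrict_scalars_inverse:
  assumes \<psi>: "\<And>a. a \<in> carrier A \<Longrightarrow> \<psi> a \<in> carrier B" and inverse: "\<And>a. a \<in> carrier A \<Longrightarrow> \<phi> (\<psi> a) = a"
    and M: "right_module A M"
  shows "restrict_scalars A \<psi> (restrict_scalars B \<phi> M) = M"
proof -
  have "act M \<in> extensional (carrier A)"
    using M by (auto simp: right_module_def additive_action_def PiE_iff)
  then have "(\<lambda>a\<in>carrier A. restrict (\<lambda>b. act M (\<phi> b)) (carrier B) (\<psi> a)) = act M"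
    by (auto simp: fun_eq_iff restrict_def \<psi> inverse extensional_def)
  then show ?thesis
    by (simp add: restrict_scalars_def)
qed

lemma categories_isomorphic_right_modules:
  assumes A: "ring A" and B: "ring B" and \<phi>: "\<phi> \<in> ring_iso B A"
  shows "categories_isomorphic (right_modules TYPE('m) A) (right_modules TYPE('m) B)"
proof -
  let ?\<psi> = "inv_into (carrier B) \<phi>"
  have hom: "\<phi> \<in> ring_hom B A" and bij: "bij_betw \<phi> (carrier B) (carrier A)"
    using \<phi> by (auto simp: ring_iso_def)
  have \<psi>: "?\<psi> \<in> ring_hom A B"
    using ring_iso_set_sym[OF B \<phi>] by (simp add: ring_iso_def)
  have inverse: "\<phi> (?\<psi> a) = a" if "a \<in> carrier A" for a
    using that bij by (simp add: bij_betw_inv_into_right)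
  have inverse': "?\<psi> (\<phi> b) = b" if "b \<in> carrier B" for b
    using that bij by (simp add: bij_betw_inv_into_left)
  have "restrict_scalars A ?\<psi> (restrict_scalars B \<phi> M) = M" if "right_module A M" for M
    using that by (intro restrict_scalars_inverse ring_hom_closed[OF \<psi>] inverse)
  moreover have "restrict_scalars B \<phi> (restrict_scalars A ?\<psi> M) = M" if "right_module B M" for M
    using that by (intro restrict_scalars_inverse ring_hom_closed[OF hom] inverse')
  ultimately have
    "\<forall>M\<in>Obj (right_modules TYPE('m) A). restrict_scalars A ?\<psi> (restrict_scalars B \<phi> M) = M"
    "\<forall>M\<in>Obj (right_modules TYPE('m) B). restrict_scalars B \<phi> (restrict_scalars A ?\<psi> M) = M"
    by (auto simp: right_modules_def module_cat_def)
  then show ?thesis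
    unfolding categories_isomorphic_def
    by (intro conjI exI[of _ "restrict_scalars B \<phi>"] exI[of _ "restrict_scalars A ?\<psi>"]
        exI[of _ "\<lambda>M N f. f"] category_right_modules is_functor_restrict_scalars A B hom \<psi>) auto
qed

theorem proposition2p14:
  fixes K :: "('k, 'c) ring_scheme" and G :: "('g, 'b) monoid_scheme"
    and \<rho> :: "'g \<Rightarrow> 'g \<Rightarrow> 'k"
  assumes "field K" and "group G" and "\<rho> \<in> pm TYPE('r) K G"
  shows "dual_factor_set G \<rho> \<in> pm TYPE('r) K G \<and>
    algebras_isomorphic K
      (twisted_partial_group_algebra K G (dual_factor_set G \<rho>))
      (opposite_algebra (twisted_partial_group_algebra K G \<rho>)) \<and>
    categories_isomorphic
      (left_modules TYPE('m) (twisted_partial_group_algebra K G \<rho>))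
      (right_modules TYPE('m) (twisted_partial_group_algebra K G (dual_factor_set G \<rho>)))"
proof -
  interpret twist K G \<rho>
  proof (intro twist.intro twist_axioms.intro)
    show "cring K"
      using \<open>field K\<close> by (intro domain.axioms field.axioms)
    show "group G" by fact
    fix g h assume "g \<in> carrier G" "h \<in> carrier G"
    then show "\<rho> g h \<in> carrier K"
      using \<open>\<rho> \<in> pm TYPE('r) K G\<close>
      by (auto simp: pm_def is_factor_set_def partial_projective_rep_with_def)
  qed
  let ?A = "twisted_partial_group_algebra K G \<rho>"
    and ?A' = "twisted_partial_group_algebra K G (dual_factor_set G \<rho>)"
  note iso = twisted_partial_group_algebra_dual_iso
  have "algebras_isomorphic K ?A' (opposite_algebra ?A)"
    unfolding algebras_isomorphic_def using iso by blast
  moreover have "categories_isomorphic (right_modules TYPE('m) (opposite_algebra ?A)) (right_modules TYPE('m) ?A')"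
    by (intro categories_isomorphic_right_modules[where \<phi> = "(`) \<theta>"]
        ring_opposite_algebra ring_twisted_partial_group_algebra
        twist.ring_twisted_partial_group_algebra[OF twist_dual])
      (use iso in \<open>simp add: algebra_iso_def\<close>)
  ultimately show ?thesis
    using dual_factor_set_pm[OF \<open>group G\<close> \<open>\<rho> \<in> pm TYPE('r) K G\<close>]
    by (simp add: right_modules_opposite_algebra)
qed

end
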